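(* Let $p\ge1$ be an integer, let $X$ be a real random variable with probability density $f_X$ such that the differential entropy $h(X)$ and $\mathbb{E}[\log|X|]$ exist and are finite, and let $a\in\mathbb{R}\setminus\{0\}$. Then the approximate floating-point entropy of $(aX)_{fp}$ has no dependence on $a$: $$\tilde H_s((aX)_{fp}) = p-\tfrac12+h(X)-\mathbb{E}[\log|X|].$$
   Context: All logarithms are base 2. $h(Y)=-\int_{\mathbb{R}} f_Y(y)\log f_Y(y)\,dy$ is the differential entropy of a random variable $Y$ with density $f_Y$. For such $Y$, $Y_{fp}$ denotes its floating-point quantization with precision $p$, and the (smoothed) approximate floating-point entropy is the quantity $$\tilde H_s(Y_{fp}) = h(Y)-\mathbb{E}[\log\Delta_s(Y)],\qquad \Delta_s(y)=\tfrac{1}{\sqrt2}|y|\,2^{1-p},$$ which depends only on the density of $Y$ and on $p$. *)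

theory Defs
  imports "HOL-Probability.Probability"
begin

(* The library entropy is minus the Kullback-Leibler divergence from Lebesgue measure; for a
   variable with density f it is - (LINT y|lborel. f y * log 2 (f y)), see diff_entropy_density. *)
abbreviation diff_entropy :: "'a measure \<Rightarrow> ('a \<Rightarrow> real) \<Rightarrow> real" where
  "diff_entropy M Y \<equiv> prob_space.entropy M 2 lborel Y"

definition smooth_spacing :: "nat \<Rightarrow> real \<Rightarrow> real" where
  "smooth_spacing p y = 1 / sqrt 2 * \<bar>y\<bar> * 2 powr (1 - real p)"

(* The value log 2 0 = 0 is irrelevant here: a variable with a density is almost surely nonzero. *)
definition approx_fp_entropy :: "'a measure \<Rightarrow> nat \<Rightarrow> ('a \<Rightarrow> real) \<Rightarrow> real" where
  "approx_fp_entropy M p Y =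
     diff_entropy M Y - (\<integral>\<omega>. log 2 (smooth_spacing p (Y \<omega>)) \<partial>M)"

lemma diff_entropy_density:
  fixes f :: "real \<Rightarrow> real"
  assumes "prob_space M" "distributed M lborel Y (\<lambda>y. ennreal (f y))" "\<And>y. 0 \<le> f y"
  shows "diff_entropy M Y = - (\<integral>y. f y * log 2 (f y) \<partial>lborel)"
proof -
  interpret prob_space M by fact
  interpret information_space M 2 by unfold_locales simp
  show ?thesis using assms(2,3) by (rule entropy_distr)
qed

lemma approx_fp_entropy_density:
  fixes f :: "real \<Rightarrow> real"
  assumes "prob_space M" "distributed M lborel Y (\<lambda>y. ennreal (f y))" "\<And>y. 0 \<le> f y"
  shows "approx_fp_entropy M p Y =
    - (\<integral>y. f y * log 2 (f y) \<partial>lborel) - (\<integral>y. f y * log 2 (smooth_spacing p y) \<partial>lborel)"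
proof -
  have "(\<lambda>y. log 2 (smooth_spacing p y)) \<in> borel_measurable lborel"
    unfolding smooth_spacing_def by measurable
  then have "(\<integral>y. f y * log 2 (smooth_spacing p y) \<partial>lborel)
      = (\<integral>\<omega>. log 2 (smooth_spacing p (Y \<omega>)) \<partial>M)"
    using assms(2,3) by (intro distributed_integral) auto
  with diff_entropy_density[OF assms] show ?thesis
    by (simp add: approx_fp_entropy_def)
qed

end

theory Submission
  imports Defs
begin

text \<open>Scaling by \<open>a\<close> adds \<open>log 2 \<bar>a\<bar>\<close> both to the differential entropy and to the expected
  logarithm of the spacing, so the two contributions cancel.\<close>

text \<open>Dividing by \<open>\<bar>a\<bar>\<close> inside \<open>ennreal\<close> presents the
  scaled density as a real function, the form that \<open>diff_entropy_density\<close>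
  takes.\<close>

lemma distributed_scale:
  fixes f :: "real \<Rightarrow> real"
  assumes "prob_space M" "distributed M lborel X (\<lambda>x. ennreal (f x))"
    and "\<And>x. 0 \<le> f x" "a \<noteq> 0"
  shows "distributed M lborel (\<lambda>\<omega>. a * X \<omega>) (\<lambda>x. ennreal (f (x / a) / \<bar>a\<bar>))"
  using prob_space.distributed_affine[OF assms(1,2,4), of 0] assms(3,4)
  by (simp add: divide_ennreal)

text \<open>A change of variables leaves \<open>f\<close> in place and only divides the argument of
  the logarithm by \<open>\<bar>a\<bar>\<close>; since \<open>f\<close> has total mass 1, this
  shifts the entropy by a constant.\<close>

lemma diff_entropy_scale:
  fixes f :: "real \<Rightarrow> real"
  assumes M: "prob_space M" and D: "distributed M lborel X (\<lambda>x. ennreal (f x))"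
    and f0: "\<And>x. 0 \<le> f x" and I: "integrable lborel (\<lambda>x. f x * log 2 (f x))" and a: "a \<noteq> 0"
  shows "diff_entropy M (\<lambda>\<omega>. a * X \<omega>) = diff_entropy M X + log 2 \<bar>a\<bar>"
proof -
  interpret prob_space M by fact
  \<comment> \<open>Integrating the constant 1 against the law of \<open>X\<close> gives both
    facts.\<close>
  have f_int: "integrable lborel f" and f1: "(\<integral>x. f x \<partial>lborel) = 1"
    using distributed_integrable[OF D, of "\<lambda>_. 1"] distributed_integral[OF D, of "\<lambda>_. 1"] f0
    by (simp_all add: prob_space)
  \<comment> \<open>Substituting \<open>y = a * x\<close> produces the Jacobian
    \<open>\<bar>a\<bar>\<close>, which cancels the \<open>1 / \<bar>a\<bar>\<close> of the scaled
    density.\<close>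
  have "(\<integral>y. f (y / a) / \<bar>a\<bar> * log 2 (f (y / a) / \<bar>a\<bar>) \<partial>lborel)
      = (\<integral>x. f x * log 2 (f x / \<bar>a\<bar>) \<partial>lborel)"
    using a by (subst lborel_integral_real_affine[of a _ 0]) simp_all
  also have "\<dots> = (\<integral>x. f x * log 2 (f x) - f x * log 2 \<bar>a\<bar> \<partial>lborel)"
  proof (rule Bochner_Integration.integral_cong)
    fix x show "f x * log 2 (f x / \<bar>a\<bar>) = f x * log 2 (f x) - f x * log 2 \<bar>a\<bar>"
      \<comment> \<open>The quotient rule for \<open>log\<close> needs \<open>f x\<close> nonzero;
        where \<open>f x = 0\<close> the outer factor makes both sides vanish.\<close>
      using a f0[of x] by (cases "f x = 0") (simp_all add: log_divide right_diff_distrib)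
  qed simp
  also have "\<dots> = (\<integral>x. f x * log 2 (f x) \<partial>lborel) - log 2 \<bar>a\<bar>"
    using I f_int f1 by simp
  finally show ?thesis
    using diff_entropy_density[OF M distributed_scale[OF M D f0 a]] diff_entropy_density[OF M D] f0
    by simp
qed

text \<open>The factor \<open>1 / sqrt 2\<close> is \<open>2 powr (- 1 / 2)\<close>, so the powers
  of 2 combine to the exponent \<open>1 / 2 - p\<close>.\<close>

lemma log_smooth_spacing:
  assumes "y \<noteq> 0"
  shows "log 2 (smooth_spacing p y) = log 2 \<bar>y\<bar> + 1 / 2 - real p"
proof -
  have "smooth_spacing p y = \<bar>y\<bar> * 2 powr (1 / 2 - real p)"
    by (simp add: smooth_spacing_def powr_half_sqrt[symmetric] divide_powr_uminus
        powr_add[symmetric])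
  with assms show ?thesis
    by (simp add: log_mult)
qed

text \<open>The law of \<open>X\<close> is absolutely continuous and a single point is Lebesgue
  null. This discards the event on which logarithms of products do not split.\<close>

lemma AE_distributed_lborel_nonzero:
  fixes X :: "'a \<Rightarrow> real"
  assumes "distributed M lborel X f"
  shows "AE \<omega> in M. X \<omega> \<noteq> 0"
proof -
  have [measurable]: "f \<in> borel_measurable borel"
    using distributed_borel_measurable[OF assms] by simp
  have "AE x in density lborel f. x \<noteq> 0"
    using AE_lborel_singleton[of "0::real"] by (auto simp: AE_density)
  then have "AE x in distr M lborel X. x \<noteq> 0"
    unfolding distributed_distr_eq_density[OF assms] .
  then show ?thesis
    using distributed_measurable[OF assms] by (simp add: AE_distr_iff)
qed

theorem theorem3:
  fixes M :: "'a measure" and X :: "'a \<Rightarrow> real" and f :: "real \<Rightarrow> real"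
    and p :: nat and a :: real
  assumes "1 \<le> p"
    and "prob_space M"
    and "distributed M lborel X (\<lambda>x. ennreal (f x))"
    and "\<And>x. 0 \<le> f x"
    and "integrable lborel (\<lambda>x. f x * log 2 (f x))"
    and "integrable M (\<lambda>\<omega>. log 2 \<bar>X \<omega>\<bar>)"
    and "a \<noteq> 0"
  shows "approx_fp_entropy M p (\<lambda>\<omega>. a * X \<omega>) =
    real p - 1 / 2 + diff_entropy M X - (\<integral>\<omega>. log 2 \<bar>X \<omega>\<bar> \<partial>M)"
proof -
  interpret prob_space M by fact
  have [measurable]: "X \<in> borel_measurable M"
    using distributed_measurable[OF assms(3)] by simp
  have "(\<integral>\<omega>. log 2 (smooth_spacing p (a * X \<omega>)) \<partial>M)
      = (\<integral>\<omega>. log 2 \<bar>X \<omega>\<bar> + (log 2 \<bar>a\<bar> + 1 / 2 - real p) \<partial>M)"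
  \<comment> \<open>The integrands agree only almost everywhere: where \<open>X\<close> vanishes,
    the convention \<open>log 2 0 = 0\<close> makes the left one 0 but the right one
    \<open>log 2 \<bar>a\<bar> + 1 / 2 - p\<close>.\<close>
  proof (rule integral_cong_AE)
    show "AE \<omega> in M. log 2 (smooth_spacing p (a * X \<omega>))
        = log 2 \<bar>X \<omega>\<bar> + (log 2 \<bar>a\<bar> + 1 / 2 - real p)"
      using AE_distributed_lborel_nonzero[OF assms(3)]
      by eventually_elim (use assms(7) in \<open>simp add: log_smooth_spacing abs_mult log_mult\<close>)
  qed (simp_all add: smooth_spacing_def)
  also have "\<dots> = (\<integral>\<omega>. log 2 \<bar>X \<omega>\<bar> \<partial>M) + log 2 \<bar>a\<bar> + 1 / 2 - real p"
    using assms(6) by (simp add: prob_space)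
  finally show ?thesis
    using diff_entropy_scale[OF assms(2-5,7)] by (simp add: approx_fp_entropy_def)
qed

end
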